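(* In the stationary case $g^t\equiv g$, let $\{z^t\}$ be the sequence of SQG-estimates at a point $x\in X$, where $g\in G$ is globally Hölder continuous at $x$ with constants $H=H(x)$, $\nu=\nu(x)>0$, and the kernel $K$ is a bounded Borel density with $\int_X K(y)\,dy=1$, $\sup_{y\in X} K(y)\le\overline K$ and $A=\int_{\mathbb{R}^r}\|y\|^{\nu}K(y)\,dy<+\infty$. Let $\rho_t=\rho/(1+t)^p$ and $\theta_t=\theta/(1+t)^q$ with $\theta>0$, $q\ge0$, $0<p\le1$, $p<\rho$. Then for any $t\ge0$ $$\mathbf{E}|z^t-g(x)|^2\le\frac{Q}{(1+t)^{\gamma}},\qquad Q=\max\Big\{|z^0-g(x)|^2,\ \frac{C}{2\rho-p}\Big\},$$ where $$C=\max\{4AH\overline g\rho\theta^{\nu},\ 2\overline g^{2}\rho^2,\ 2\overline K\,\overline g\rho^2\theta^{-r}\},\qquad \gamma=\min\{\nu q,\ p,\ p-rq\}.$$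
   Context: Let $X\subseteq\mathbb{R}^r$. $G$ is the class of functions $g$ on $X$ with $0\le\underline g(x)\le g(x)\le\overline g(x)\le\overline g$ for all $x\in X$, where $\underline g(\cdot),\overline g(\cdot)$ are given functions and $\overline g$ is a finite constant. $g$ is a probability density on $X$; the observations $\overline x_0,\overline x_1,\dots$ are i.i.d. random vectors with density $g$ on a probability space $(\Omega,\Sigma,P)$. $K\ge0$ is a kernel. Global Hölder continuity at $x$: there are $H=H(x)$ and $\nu=\nu(x)>0$ such that $|g(x)-g(y)|\le H\|x-y\|^{\nu}$ for all $y\in X$. SQG-estimates at $x$: given $z^0\in[\underline g(x),\overline g(x)]$, adjustment coefficients $\rho_t$ and window parameters $\theta_t$, $$z^{t+1}=\min\{\overline g(x),\max\{\underline g(x),\,z^t-\rho_t\xi_t\}\},\qquad \xi_t=z^t-\frac1{\theta_t^r}K\Big(\frac{\overline x_t-x}{\theta_t}\Big),\quad t=0,1,\dots$$ $\mathbf{E}$ denotes expectation.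
   Formalization: Added: for every t the rescaled kernel θ_t^{-r}K((y-x)/θ_t) has integral 1 over X (automatic if X=R^r); without it the bound fails, e.g. X=[0,1], x=1, g=1, K=1_[0,1]. X is taken Borel, and K is read as a probability density on R^r. *)

theory Defs
  imports "HOL-Probability.Probability"
begin

definition prob_density_on :: "'a::euclidean_space set \<Rightarrow> ('a \<Rightarrow> real) \<Rightarrow> bool" where
  "prob_density_on S f \<longleftrightarrow>
     (\<forall>y\<in>S. 0 \<le> f y) \<and> set_integrable lborel S f \<and> (LINT y:S|lborel. f y) = 1"

definition density_class ::
  "'a set \<Rightarrow> ('a \<Rightarrow> real) \<Rightarrow> ('a \<Rightarrow> real) \<Rightarrow> real \<Rightarrow> ('a \<Rightarrow> real) set" where
  "density_class X glo gup gbar =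
     {g. \<forall>x\<in>X. 0 \<le> glo x \<and> glo x \<le> g x \<and> g x \<le> gup x \<and> gup x \<le> gbar}"

definition globally_holder_at ::
  "'a::real_normed_vector set \<Rightarrow> ('a \<Rightarrow> real) \<Rightarrow> 'a \<Rightarrow> real \<Rightarrow> real \<Rightarrow> bool" where
  "globally_holder_at X g x H \<nu> \<longleftrightarrow>
     \<nu> > 0 \<and> (\<forall>y\<in>X. \<bar>g x - g y\<bar> \<le> H * norm (x - y) powr \<nu>)"

definition scaled_kernel ::
  "('a::euclidean_space \<Rightarrow> real) \<Rightarrow> real \<Rightarrow> 'a \<Rightarrow> 'a \<Rightarrow> real" where
  "scaled_kernel K h x y = 1 / h ^ DIM('a) * K ((y - x) /\<^sub>R h)"

primrec sqg_estimate ::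
  "('a::euclidean_space \<Rightarrow> real) \<Rightarrow> ('a \<Rightarrow> real) \<Rightarrow> ('a \<Rightarrow> real) \<Rightarrow> (nat \<Rightarrow> real) \<Rightarrow>
   (nat \<Rightarrow> real) \<Rightarrow> (nat \<Rightarrow> '\<omega> \<Rightarrow> 'a) \<Rightarrow> 'a \<Rightarrow> real \<Rightarrow> nat \<Rightarrow> '\<omega> \<Rightarrow> real" where
  "sqg_estimate K glo gup \<rho> \<theta> xbar x z0 0 \<omega> = z0"
| "sqg_estimate K glo gup \<rho> \<theta> xbar x z0 (Suc t) \<omega> =
     (let z = sqg_estimate K glo gup \<rho> \<theta> xbar x z0 t \<omega>;
          \<xi> = z - scaled_kernel K (\<theta> t) x (xbar t \<omega>)
      in min (gup x) (max (glo x) (z - \<rho> t * \<xi>)))"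

end

theory Submission
  imports Defs
begin

text \<open>Write \<open>n = 1 + t\<close>, \<open>m = \<rho>\<^sub>t\<close>, \<open>e\<close> and \<open>S\<close> for the first two moments of the scaled kernel
  \<open>\<kappa>\<close> at \<open>x\<^sub>t\<close>, and \<open>D = C / n powr (p + \<gamma>)\<close>. Since clipping to an interval containing \<open>g x\<close>
  is a contraction and \<open>z\<^sub>t\<close> is independent of \<open>\<kappa>\<close>, the next squared error is at most the mean of
  the quadratic \<open>((1 - m) z - g)\<^sup>2 + 2 m ((1 - m) z - g) e + m\<^sup>2 S\<close> at \<open>z = z\<^sub>t\<close>.

  If \<open>m \<le> 1/2\<close>, the quadratic is at most \<open>(1 - 2 m) (z - g)\<^sup>2 + D\<close>. That the second moment of
  \<open>\<xi>\<close> is bounded by the maximum and not the sum of its two natural bounds is what makes the constant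
  \<open>C\<close> suffice: the moment is affine in \<open>e\<close>, so it is enough to look at \<open>e = 0\<close> and \<open>e = G\<close>,
  where \<open>G\<close> is the uniform bound on the density.
  The rate is then propagated by \<open>(1 - p / n powr p) (1 + 1/n) powr \<gamma> \<le> 1\<close>.

  If \<open>m > 1/2\<close>, the factor \<open>1 - 2 m\<close> is negative and the induction hypothesis is useless. Here
  \<open>(2 m - p / n powr p) (1 + 1/n) powr \<gamma> \<le> (m + 1/2)\<^sup>2\<close>, so it suffices to bound the squared error
  by \<open>D / (m + 1/2)\<^sup>2\<close> outright. This is trivial if \<open>D \<ge> (m + 1/2)\<^sup>2 G\<^sup>2\<close>; otherwise
  \<open>2 m\<^sup>2 < (m + 1/2)\<^sup>2\<close>, which forces \<open>m \<le> 1.21\<close>, and the quadratic, being convex in \<open>z\<close> and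
  affine in \<open>e\<close>, can be estimated at the end points.\<close>

section \<open>One step with fixed moments\<close>

text \<open>After expansion, the terms beyond \<open>(1 - 2 * m) * (z - g)^2\<close> are a bias term
  \<open>2 * m * (z - g) * (e - g)\<close> and \<open>m^2\<close> times the second moment of
  \<open>z\<close> minus the kernel value. Each receives half of \<open>D\<close>.\<close>

lemma step_moment_le:
  fixes m z g e S k D G b :: real
  assumes "0 \<le> m" "0 \<le> z" "z \<le> G" "0 \<le> g" "g \<le> G" "0 \<le> e" "e \<le> G" "0 < G" "S \<le> k * e"
    "2 * m\<^sup>2 * G\<^sup>2 \<le> D" "2 * m\<^sup>2 * k * G \<le> D" "\<bar>e - g\<bar> \<le> b" "4 * m * G * b \<le> D"
  shows "((1 - m) * z - g)\<^sup>2 + 2 * m * ((1 - m) * z - g) * e + m\<^sup>2 * S \<le> (1 - 2 * m) * (z - g)\<^sup>2 + D"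
proof -
  have "(z - g) * (e - g) \<le> \<bar>z - g\<bar> * \<bar>e - g\<bar>"
    by (metis abs_ge_self abs_mult)
  also have "\<dots> \<le> G * b"
    using assms by (intro mult_mono) auto
  finally have "2 * m * ((z - g) * (e - g)) \<le> 2 * m * (G * b)"
    using assms by (intro mult_left_mono) auto
  then have 1: "2 * m * ((z - g) * (e - g)) \<le> D / 2"
    using assms(13) by (simp add: algebra_simps)
  \<comment> \<open>Multiplying by \<open>G\<close> turns \<open>G - e\<close> and \<open>e\<close>
    into nonnegative weights of total \<open>G\<close>. The two bounds \<open>G^2\<close> and
    \<open>k * G\<close> are then averaged instead of added.\<close>
  have "G * (z\<^sup>2 - 2 * z * e + S) \<le> (G - e) * z\<^sup>2 + e * (z * (z - G) - z * G + k * G)"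
    using mult_left_mono[OF assms(9), of G] assms by (simp add: algebra_simps power2_eq_square)
  also have "\<dots> \<le> (G - e) * G\<^sup>2 + e * (k * G)"
  proof (intro add_mono mult_left_mono)
    show "z * (z - G) - z * G + k * G \<le> k * G"
      using mult_nonneg_nonpos[of z "z - G"] mult_nonneg_nonneg[of z G] assms by linarith
  qed (use assms in \<open>auto intro: power_mono\<close>)
  finally have "m\<^sup>2 * (G * (z\<^sup>2 - 2 * z * e + S)) \<le> m\<^sup>2 * ((G - e) * G\<^sup>2 + e * (k * G))"
    by (intro mult_left_mono) auto
  also have "\<dots> = (G - e) * (m\<^sup>2 * G\<^sup>2) + e * (m\<^sup>2 * k * G)"
    by (simp add: algebra_simps)
  also have "\<dots> \<le> (G - e) * (D / 2) + e * (D / 2)"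
    using assms by (intro add_mono mult_left_mono) auto
  also have "\<dots> = G * (D / 2)"
    by (simp add: field_simps)
  finally have "G * (m\<^sup>2 * (z\<^sup>2 - 2 * z * e + S)) \<le> G * (D / 2)"
    by (simp add: algebra_simps)
  then have 2: "m\<^sup>2 * (z\<^sup>2 - 2 * z * e + S) \<le> D / 2"
    using assms(8) by (simp only: mult_le_cancel_left_pos)
  have "((1 - m) * z - g)\<^sup>2 + 2 * m * ((1 - m) * z - g) * e + m\<^sup>2 * S
    = (1 - 2 * m) * (z - g)\<^sup>2 + 2 * m * ((z - g) * (e - g)) + m\<^sup>2 * (z\<^sup>2 - 2 * z * e + S)"
    by (simp add: algebra_simps power2_eq_square)
  then show ?thesis using 1 2 by linarith
qed

section \<open>Squared error after a step with \<open>m > 1/2\<close>\<close>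

text \<open>The two parts treat \<open>z = 0\<close> and \<open>z = 1\<close> for
  \<open>G = 1\<close>. Once \<open>m^2 * S\<close> is replaced by \<open>D / 2 * e\<close>, the
  expression is affine in \<open>e\<close>, and the sign of its slope selects
  \<open>e = g + \<beta>\<close> or \<open>e = g - \<beta>\<close>. The resulting quadratic in
  \<open>g\<close> is largest at \<open>g = 0\<close> in the first case and at \<open>g = 1\<close>
  in the second; these values are the two entries of each \<open>max\<close>.\<close>

lemma overshoot_endpoint_le:
  fixes m z g e S k D :: real
  assumes m: "1/2 < m" and g: "0 \<le> g" "g \<le> 1" and e: "0 \<le> e" and S: "S \<le> k * e"
    and D: "2 * m\<^sup>2 \<le> D" "2 * m\<^sup>2 * k \<le> D" "4 * m * \<bar>e - g\<bar> \<le> D"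
  shows "(0 - g)\<^sup>2 + 2 * m * (0 - g) * e + m\<^sup>2 * S \<le> max (D\<^sup>2 / (8 * m)) (1 - 2*m + D - D\<^sup>2/(8*m))"
    "(1 - m - g)\<^sup>2 + 2 * m * (1 - m - g) * e + m\<^sup>2 * S \<le>
      max ((1 - m)\<^sup>2 + (1 - m) * D / 2 + D\<^sup>2 / (8 * m)) (- (m\<^sup>2) + (1 + m) * D / 2 - D\<^sup>2/(8*m))"
proof -
  \<comment> \<open>the bias bound: \<open>e\<close> ranges over \<open>[g - \<beta>, g + \<beta>]\<close>\<close>
  define \<beta> where "\<beta> = D / (4 * m)"
  have Db: "D = 4 * m * \<beta>" using m by (simp add: \<beta>_def)
  have sq: "D\<^sup>2 / (8 * m) = 2 * m * \<beta>\<^sup>2" using m by (simp add: Db power2_eq_square)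
  have eb: "e \<le> g + \<beta>" "g - \<beta> \<le> e"
    using D(3) m unfolding Db by auto
  have "m\<^sup>2 * S \<le> (m\<^sup>2 * k) * e"
    using mult_left_mono[OF S, of "m\<^sup>2"] by (simp add: algebra_simps)
  also have "\<dots> \<le> D / 2 * e" using D(2) e by (intro mult_right_mono) auto
  also have "D / 2 * e = 2 * m * \<beta> * e" by (simp add: Db)
  finally have S': "m\<^sup>2 * S \<le> 2 * m * \<beta> * e" .
  have mg: "0 \<le> (2 * m - 1) * g\<^sup>2" using m by simp
  show "(0 - g)\<^sup>2 + 2 * m * (0 - g) * e + m\<^sup>2 * S \<le> max (D\<^sup>2 / (8 * m)) (1 - 2*m + D - D\<^sup>2/(8*m))"
  proof (cases "g \<le> \<beta>")
    case True
    have "(2 * m * (\<beta> - g)) * e \<le> (2 * m * (\<beta> - g)) * (g + \<beta>)"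
      using True eb m by (intro mult_left_mono) auto
    then have "(0 - g)\<^sup>2 + 2 * m * (0 - g) * e + m\<^sup>2 * S \<le> 2 * m * \<beta>\<^sup>2"
      using S' mg by (simp add: algebra_simps power2_eq_square)
    then show ?thesis unfolding sq by simp
  next
    case False
    have "(2 * m * (g - \<beta>)) * (g - \<beta>) \<le> (2 * m * (g - \<beta>)) * e"
      using False eb m by (intro mult_left_mono) auto
    then have "(0 - g)\<^sup>2 + 2 * m * (0 - g) * e + m\<^sup>2 * S \<le> g\<^sup>2 - 2 * m * (g - \<beta>)\<^sup>2"
      using S' by (simp add: algebra_simps power2_eq_square)
    also have "\<dots> \<le> 1 - 2 * m + D - D\<^sup>2/(8*m)"
    proof -
      \<comment> \<open>This product is the value of the quadratic at \<open>g = 1\<close> minus its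
        value at \<open>g\<close>.\<close>
      have "0 \<le> (1 - g) * (4 * m * \<beta> - (2 * m - 1) * (1 + g))"
      proof (intro mult_nonneg_nonneg)
        have "(2 * m - 1) * (1 + g) \<le> (2 * m - 1) * 2"
          using g m by (intro mult_left_mono) auto
        moreover have "0 \<le> (m - 1)\<^sup>2" by simp
        ultimately show "0 \<le> 4 * m * \<beta> - (2 * m - 1) * (1 + g)"
          using D(1) unfolding Db by (simp add: algebra_simps power2_eq_square)
      qed (use g in auto)
      then show ?thesis unfolding sq unfolding Db by (simp add: algebra_simps power2_eq_square)
    qed
    finally show ?thesis by simp
  qed
  show "(1 - m - g)\<^sup>2 + 2 * m * (1 - m - g) * e + m\<^sup>2 * S \<le>
      max ((1 - m)\<^sup>2 + (1 - m) * D / 2 + D\<^sup>2 / (8 * m)) (- (m\<^sup>2) + (1 + m) * D / 2 - D\<^sup>2/(8*m))"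
  proof (cases "g \<le> 1 - m + \<beta>")
    case True
    have "(2 * m * (1 - m - g + \<beta>)) * e \<le> (2 * m * (1 - m - g + \<beta>)) * (g + \<beta>)"
      using True eb m by (intro mult_left_mono) auto
    then have "(1 - m - g)\<^sup>2 + 2 * m * (1 - m - g) * e + m\<^sup>2 * S \<le>
       (1 - m - g)\<^sup>2 + (2 * m * (1 - m - g + \<beta>)) * (g + \<beta>)"
      using S' by (simp add: algebra_simps)
    also have "\<dots> = (1 - m)\<^sup>2 + (1 - m) * (2 * m * \<beta>) + 2 * m * \<beta>\<^sup>2 - 2 * ((1 - m)\<^sup>2 * g) - (2 * m - 1) * g\<^sup>2"
      by (simp add: algebra_simps power2_eq_square)
    also have "\<dots> \<le> (1 - m)\<^sup>2 + (1 - m) * (2 * m * \<beta>) + 2 * m * \<beta>\<^sup>2"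
      using mg mult_nonneg_nonneg[OF zero_le_power2 g(1), of "1 - m"] by linarith
    also have "\<dots> = (1 - m)\<^sup>2 + (1 - m) * D / 2 + D\<^sup>2 / (8 * m)"
      unfolding sq unfolding Db by simp
    finally show ?thesis by simp
  next
    case False
    have "(2 * m * (g - (1 - m) - \<beta>)) * (g - \<beta>) \<le> (2 * m * (g - (1 - m) - \<beta>)) * e"
      using False eb m by (intro mult_left_mono) auto
    then have "(1 - m - g)\<^sup>2 + 2 * m * (1 - m - g) * e + m\<^sup>2 * S \<le>
       (1 - m - g)\<^sup>2 - (2 * m * (g - (1 - m) - \<beta>)) * (g - \<beta>)"
      using S' by (simp add: algebra_simps)
    also have "\<dots> \<le> - (m\<^sup>2) + (1 + m) * D / 2 - D\<^sup>2/(8*m)"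
    proof -
      \<comment> \<open>Again the value at \<open>g = 1\<close> minus the value at \<open>g\<close>,
        in factored form.\<close>
      have "0 \<le> (1 - g) * (4 * m * \<beta> - 2 * (1 - m)\<^sup>2 - (2 * m - 1) * (1 + g))"
      proof (intro mult_nonneg_nonneg)
        have "(2 * m - 1) * (1 + g) \<le> (2 * m - 1) * 2"
          using g m by (intro mult_left_mono) auto
        then show "0 \<le> 4 * m * \<beta> - 2 * (1 - m)\<^sup>2 - (2 * m - 1) * (1 + g)"
          using D(1) unfolding Db by (simp add: algebra_simps power2_eq_square)
      qed (use g in auto)
      then show ?thesis unfolding sq unfolding Db by (simp add: algebra_simps power2_eq_square)
    qed
    finally show ?thesis by simp
  qed
qed


text \<open>The left sides are the four end-point values. Those with \<open>- D^2 / (8 * m)\<close>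
  are handled by maximizing a concave parabola in \<open>D\<close>, the others by
  \<open>D \<le> u\<close>, where \<open>u = (m + 1/2)^2\<close>. What remains is a polynomial
  inequality in \<open>m\<close> on a short interval.\<close>

lemma overshoot_scalar_le:
  fixes m D :: real
  assumes m: "1/2 < m" and D: "2 * m\<^sup>2 \<le> D" "D \<le> (m + 1/2)\<^sup>2"
  shows "D\<^sup>2 / (8 * m) \<le> D / (m + 1/2)\<^sup>2"
    "1 - 2*m + D - D\<^sup>2/(8*m) \<le> D / (m + 1/2)\<^sup>2"
    "(1 - m)\<^sup>2 + (1 - m) * D / 2 + D\<^sup>2 / (8 * m) \<le> D / (m + 1/2)\<^sup>2"
    "- (m\<^sup>2) + (1 + m) * D / 2 - D\<^sup>2/(8*m) \<le> D / (m + 1/2)\<^sup>2"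
proof -
  define u where "u = (m + 1/2)\<^sup>2"
  have u: "u = m\<^sup>2 + m + 1/4" by (simp add: u_def power2_eq_square algebra_simps)
  have m2: "m\<^sup>2 \<le> m + 1/4" using D unfolding u_def[symmetric] u by simp
  \<comment> \<open>The positive root of \<open>m^2 = m + 1/4\<close> is
    \<open>(1 + sqrt 2) / 2 = 1.207...\<close>, here rounded up.\<close>
  have m_le: "m \<le> 121/100"
  proof (rule ccontr)
    assume "\<not> m \<le> 121/100"
    then have "(121/100) * (21/100) < m * (m - 1)" by (intro mult_strict_mono) auto
    then show False using m2 by (simp add: power2_eq_square algebra_simps)
  qed
  \<comment> \<open>chords over \<open>[1/2, 1.21]\<close> reduce the one-variable polynomial inequalities below to linear ones\<close>
  have chord: "m\<^sup>2 \<le> 171/100 * m - 605/1000"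
  proof -
    have "0 \<le> (m - 1/2) * (121/100 - m)" using m m_le by simp
    also have "\<dots> = 171/100 * m - 605/1000 - m\<^sup>2" by (simp add: power2_eq_square field_simps)
    finally show ?thesis by simp
  qed
  have u_le: "u \<le> 271/100 * m - 355/1000" using chord by (simp add: u)
  have u1: "1 \<le> u" using m by (simp add: u_def one_le_power)
  have "0 < m\<^sup>2" using m by simp
  then have Dpos: "0 < D" using D(1) by linarith
  have uu: "u * u \<le> 8 * m"
  proof -
    have "u * u \<le> (271/100 * m - 355/1000) * (271/100 * m - 355/1000)"
      using u_le u1 by (intro mult_mono) auto
    also have "\<dots> = (271/100)\<^sup>2 * m\<^sup>2 - 2 * (271/100) * (355/1000) * m + (355/1000)\<^sup>2"
      by (simp add: power2_eq_square algebra_simps)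
    also have "\<dots> \<le> (271/100)\<^sup>2 * (171/100 * m - 605/1000) - 2 * (271/100) * (355/1000) * m + (355/1000)\<^sup>2"
      using chord by (intro add_mono diff_mono mult_left_mono) auto
    also have "\<dots> \<le> 8 * m" using m_le m by (simp add: power2_eq_square algebra_simps)
    finally show ?thesis .
  qed
  \<comment> \<open>the maximum over \<open>D\<close> of the concave parabola on the left\<close>
  have vertex: "\<alpha> * D - D\<^sup>2 / (8 * m) \<le> 2 * m * \<alpha>\<^sup>2" for \<alpha>
  proof -
    have "0 \<le> (D - 4 * m * \<alpha>)\<^sup>2 / (8 * m)" using m by simp
    also have "\<dots> = D\<^sup>2 / (8 * m) - \<alpha> * D + 2 * m * \<alpha>\<^sup>2"
      using m by (simp add: power2_eq_square field_simps)
    finally show ?thesis by simp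
  qed
  have Du: "D\<^sup>2 / (8 * m) \<le> D * (u / (8 * m))"
    using D m Dpos by (simp add: u_def power2_eq_square divide_right_mono)
  have um: "u / (8 * m) \<le> 1 / u" using uu u1 m by (simp add: field_simps)
  show i: "D\<^sup>2 / (8 * m) \<le> D / (m + 1/2)\<^sup>2"
    using Du mult_left_mono[OF um, of D] Dpos by (simp add: u_def)
  show "1 - 2*m + D - D\<^sup>2/(8*m) \<le> D / (m + 1/2)\<^sup>2"
  proof -
    \<comment> \<open>With \<open>D / u\<close> moved to the left, \<open>\<alpha>\<close> is the
      coefficient of \<open>D\<close>. By \<open>vertex\<close> it suffices that
      \<open>m * \<alpha>^2 \<le> m - 1/2\<close>.\<close>
    define \<alpha> where "\<alpha> = 1 - 1 / u"
    have au: "\<alpha> * u = (m - 1/2) * (m + 3/2)"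
      using u1 by (simp add: \<alpha>_def u field_simps power2_eq_square)
    have "m * (m - 1/2) * (m + 3/2)\<^sup>2 \<le> u\<^sup>2"
    proof -
      have "0 \<le> m * (13/8 + 3/4 * m - m\<^sup>2 / 2) + 1/16"
        using m m_le chord by (intro add_nonneg_nonneg mult_nonneg_nonneg) auto
      also have "\<dots> = u\<^sup>2 - m * (m - 1/2) * (m + 3/2)\<^sup>2"
        by (simp add: u field_simps power2_eq_square)
      finally show ?thesis by simp
    qed
    then have "(m - 1/2) * (m * (m - 1/2) * (m + 3/2)\<^sup>2) \<le> (m - 1/2) * u\<^sup>2"
      using m by (intro mult_left_mono) auto
    moreover have "(m - 1/2) * (m * (m - 1/2) * (m + 3/2)\<^sup>2) = m * (\<alpha> * u)\<^sup>2"
      unfolding au power_mult_distrib power2_eq_square by (simp only: ac_simps)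
    ultimately have "(m * \<alpha>\<^sup>2) * u\<^sup>2 \<le> (m - 1/2) * u\<^sup>2"
      by (simp add: power_mult_distrib algebra_simps)
    then have "m * \<alpha>\<^sup>2 \<le> m - 1/2"
      using u1 by (simp add: mult_le_cancel_right)
    then have "\<alpha> * D - D\<^sup>2 / (8 * m) \<le> 2 * m - 1" using vertex[of \<alpha>] by simp
    then show ?thesis unfolding u_def[symmetric] by (simp add: \<alpha>_def algebra_simps)
  qed
  show "(1 - m)\<^sup>2 + (1 - m) * D / 2 + D\<^sup>2 / (8 * m) \<le> D / (m + 1/2)\<^sup>2"
  \<comment> \<open>For \<open>m \<ge> 1\<close> the first two summands together are at most zero,
    leaving the first inequality. For \<open>m < 1\<close>, the bounds
    \<open>2 * m^2 \<le> D \<le> u\<close> allow a factor \<open>D\<close> to be cancelled.\<close>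
  proof (cases "1 \<le> m")
    case True
    have "m * 1 \<le> m * m" using True by (intro mult_left_mono) auto
    then have "m - 1 \<le> D / 2"
      using D(1) unfolding power2_eq_square by linarith
    then have "(m - 1) * (m - 1 - D / 2) \<le> 0"
      using True by (intro mult_nonneg_nonpos) auto
    moreover have "(m - 1) * (m - 1 - D / 2) = (1 - m)\<^sup>2 + (1 - m) * D / 2"
      by (simp add: field_simps power2_eq_square)
    ultimately show ?thesis using i by linarith
  next
    case False
    \<comment> \<open>In powers of \<open>s\<close> the polynomial to be checked has a single
      negative term, \<open>- 5 * s^3\<close>, which \<open>5 * s\<close> absorbs since
      \<open>s \<le> 1/2\<close>.\<close>
    define s where "s = m - 1/2"
    have ms: "m = s + 1/2" by (simp add: s_def)
    have s: "0 < s" "s \<le> 1/2" using m False by (auto simp: s_def)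
    have "s\<^sup>2 \<le> (1/2)\<^sup>2" using s by (intro power_mono) auto
    then have "s * s\<^sup>2 \<le> s * (1/4)" using s by (intro mult_left_mono) (auto simp: power2_eq_square)
    moreover have "8 * m\<^sup>2 - u * (4 * (1 - m)\<^sup>2 + 4 * m\<^sup>2 * (1 - m) + m * u)
      = 5 * s + 7/2 * s^2 - 5 * (s * s\<^sup>2) + 3/2 * s^4 + 3 * s^5"
      by (simp add: u ms power2_eq_square field_simps power_numeral_reduce)
    ultimately have "0 \<le> 8 * m\<^sup>2 - u * (4 * (1 - m)\<^sup>2 + 4 * m\<^sup>2 * (1 - m) + m * u)"
      using s zero_le_power[of s 2] zero_le_power[of s 4] zero_le_power[of s 5] by linarith
    then have "(1 - m)\<^sup>2 / (2 * m\<^sup>2) + (1 - m) / 2 + u / (8 * m) \<le> 1 / u"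
      using m u1 by (simp add: field_simps power2_eq_square)
    then have "D * ((1 - m)\<^sup>2 / (2 * m\<^sup>2) + (1 - m) / 2 + u / (8 * m)) \<le> D * (1 / u)"
      using Dpos by (intro mult_left_mono) auto
    moreover have "(1 - m)\<^sup>2 \<le> D * ((1 - m)\<^sup>2 / (2 * m\<^sup>2))"
      using mult_right_mono[OF D(1), of "(1 - m)\<^sup>2 / (2 * m\<^sup>2)"] m by simp
    ultimately show ?thesis using Du unfolding u_def[symmetric] by (simp add: algebra_simps)
  qed
  show "- (m\<^sup>2) + (1 + m) * D / 2 - D\<^sup>2/(8*m) \<le> D / (m + 1/2)\<^sup>2"
  proof -
    \<comment> \<open>Here \<open>vertex\<close> asks for
      \<open>2 * m * \<alpha>^2 \<le> m^2\<close>. The bound \<open>64/100 * m\<close> on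
      \<open>\<bar>\<alpha>\<bar>\<close> is enough because
      \<open>2 * 0.64^2 * 1.21 < 1\<close>.\<close>
    define \<alpha> where "\<alpha> = (1 + m) / 2 - 1 / u"
    have "(1/2 - 14/100 * m) * u \<le> (1/2 - 14/100 * m) * (271/100 * m - 355/1000)"
      using u_le m_le by (intro mult_left_mono) auto
    also have "\<dots> \<le> 1"
    proof -
      have "(1/2 - 14/100 * m) * (271/100 * m - 355/1000) = 14047/10000 * m - 3794/10000 * m\<^sup>2 - 1775/10000"
        by (simp add: power2_eq_square field_simps)
      moreover have "0 \<le> m\<^sup>2 - 242/100 * m + 14641/10000"
        using zero_le_power2[of "m - 121/100"] by (simp add: power2_eq_square field_simps)
      ultimately show ?thesis using m_le by linarith
    qed
    finally have "\<alpha> \<le> 64/100 * m" using u1 by (simp add: \<alpha>_def field_simps)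
    moreover have "1 / u \<le> 1" using u1 by simp
    then have "(1 + m) / 2 - 1 \<le> \<alpha>" unfolding \<alpha>_def by (rule diff_left_mono)
    moreover have "- (64/100 * m) \<le> (1 + m) / 2 - 1" using m by (simp add: field_simps)
    ultimately have "\<bar>\<alpha>\<bar> \<le> 64/100 * m" by (intro abs_leI) auto
    then have "\<alpha>\<^sup>2 \<le> (64/100 * m)\<^sup>2" by (metis abs_ge_zero power2_abs power_mono)
    then have "2 * m * \<alpha>\<^sup>2 \<le> 2 * m * (64/100 * m)\<^sup>2" using m by (intro mult_left_mono) auto
    also have "\<dots> = m\<^sup>2 * (2 * (64/100)\<^sup>2 * m)" by (simp add: power2_eq_square)
    also have "\<dots> \<le> m\<^sup>2 * 1" using m_le by (intro mult_left_mono) (auto simp: power2_eq_square)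
    finally have "\<alpha> * D - D\<^sup>2 / (8 * m) \<le> m\<^sup>2" using vertex[of \<alpha>] by simp
    then show ?thesis unfolding u_def[symmetric] by (simp add: \<alpha>_def algebra_simps add_divide_distrib)
  qed
qed

text \<open>The left side is convex in \<open>z\<close> with leading coefficient
  \<open>(1 - m)^2\<close>, so it lies below its chord over \<open>[0, 1]\<close>.\<close>

lemma overshoot_moment_le_unit:
  fixes m z g e S k D :: real
  assumes m: "1/2 < m" and z: "0 \<le> z" "z \<le> 1" and g: "0 \<le> g" "g \<le> 1" and e: "0 \<le> e" and S: "S \<le> k * e"
    and D: "2 * m\<^sup>2 \<le> D" "2 * m\<^sup>2 * k \<le> D" "4 * m * \<bar>e - g\<bar> \<le> D" "D \<le> (m + 1/2)\<^sup>2"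
  shows "((1 - m) * z - g)\<^sup>2 + 2 * m * ((1 - m) * z - g) * e + m\<^sup>2 * S \<le> D / (m + 1/2)\<^sup>2"
proof -
  define \<Phi> where "\<Phi> y = ((1 - m) * y - g)\<^sup>2 + 2 * m * ((1 - m) * y - g) * e + m\<^sup>2 * S" for y
  have "\<Phi> 0 \<le> D / (m + 1/2)\<^sup>2" "\<Phi> 1 \<le> D / (m + 1/2)\<^sup>2"
    using overshoot_endpoint_le[OF m g e S D(1-3)] overshoot_scalar_le[OF m D(1,4)] by (auto simp: \<Phi>_def)
  then have "z * \<Phi> 1 + (1 - z) * \<Phi> 0 \<le> D / (m + 1/2)\<^sup>2"
    using z by (intro convex_bound_le) auto
  moreover have "z * \<Phi> 1 + (1 - z) * \<Phi> 0 - \<Phi> z = (1 - m)\<^sup>2 * (z * (1 - z))"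
    by (simp add: \<Phi>_def algebra_simps power2_eq_square)
  moreover have "0 \<le> (1 - m)\<^sup>2 * (z * (1 - z))" using z by simp
  ultimately show ?thesis unfolding \<Phi>_def by linarith
qed

text \<open>Homogeneity reduces this to \<open>G = 1\<close>: \<open>z\<close>, \<open>g\<close>,
  \<open>e\<close> and \<open>k\<close> scale like \<open>G\<close>, while \<open>S\<close> and
  \<open>D\<close> scale like \<open>G^2\<close>.\<close>

lemma overshoot_moment_le:
  fixes m z g e S k D G b :: real
  assumes "1/2 < m" "0 \<le> z" "z \<le> G" "0 \<le> g" "g \<le> G" "0 \<le> e" "0 < G" "S \<le> k * e"
    "2 * m\<^sup>2 * G\<^sup>2 \<le> D" "2 * m\<^sup>2 * k * G \<le> D" "\<bar>e - g\<bar> \<le> b" "4 * m * G * b \<le> D"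
    "D \<le> (m + 1/2)\<^sup>2 * G\<^sup>2"
  shows "((1 - m) * z - g)\<^sup>2 + 2 * m * ((1 - m) * z - g) * e + m\<^sup>2 * S \<le> D / (m + 1/2)\<^sup>2"
proof -
  have *: "4 * m * G * \<bar>e - g\<bar> \<le> D"
    by (rule order_trans[OF mult_left_mono[OF assms(11)] assms(12)]) (use assms in auto)
  have "((1 - m) * (z / G) - g / G)\<^sup>2 + 2 * m * ((1 - m) * (z / G) - g / G) * (e / G) + m\<^sup>2 * (S / G\<^sup>2)
    \<le> (D / G\<^sup>2) / (m + 1/2)\<^sup>2"
  proof (rule overshoot_moment_le_unit[where k = "k / G"])
    show "4 * m * \<bar>e / G - g / G\<bar> \<le> D / G\<^sup>2"
      using * assms(7) by (simp add: diff_divide_distrib[symmetric] abs_div field_simps power2_eq_square)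
  qed (use assms in \<open>auto simp: field_simps power2_eq_square\<close>)
  also have "((1 - m) * (z / G) - g / G)\<^sup>2 + 2 * m * ((1 - m) * (z / G) - g / G) * (e / G) + m\<^sup>2 * (S / G\<^sup>2)
     = (((1 - m) * z - g)\<^sup>2 + 2 * m * ((1 - m) * z - g) * e + m\<^sup>2 * S) / G\<^sup>2"
    using assms(7) by (simp add: field_simps power2_eq_square)
  finally show ?thesis using assms(7) by (simp add: field_simps)
qed

section \<open>Propagation of the rate\<close>

text \<open>Monotonicity in the exponent, which also covers negative \<open>\<gamma>\<close>,
  followed by weighted AM-GM for \<open>1 + 1 / n\<close> and \<open>1\<close>.\<close>

lemma one_plus_powr_le:
  fixes n p \<gamma> :: real
  assumes "1 \<le> n" "0 < p" "p \<le> 1" "\<gamma> \<le> p"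
  shows "(1 + 1 / n) powr \<gamma> \<le> 1 + p / n"
proof -
  have "(1 + 1 / n) powr \<gamma> \<le> (1 + 1 / n) powr p"
    using assms by (intro powr_mono) auto
  also have "\<dots> \<le> p * (1 + 1 / n) + (1 - p) * 1"
    using Youngs_inequality_0[of p "1 - p" "1 + 1 / n" 1] assms by (simp add: add_pos_nonneg)
  also have "\<dots> = 1 + p / n" by (simp add: algebra_simps)
  finally show ?thesis .
qed

context
  fixes n p \<gamma> \<rho> C Q :: real
  assumes n: "1 \<le> n" and p: "0 < p" "p \<le> 1" "p < \<rho>" and \<gamma>: "\<gamma> \<le> p" and Q: "C \<le> (2 * \<rho> - p) * Q" "0 \<le> Q"
begin

lemma powr_exponent_bounds: "0 < n powr p" "n powr p \<le> n"
  using n p powr_mono[of p 1 n] by auto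

lemma powr_Suc_factor: "(n + 1) powr \<gamma> = n powr \<gamma> * (1 + 1 / n) powr \<gamma>"
proof -
  have "n + 1 = n * (1 + 1 / n)" using n by (simp add: field_simps)
  then show ?thesis using n by (simp only: powr_mult)
qed

text \<open>The nonnegative factor \<open>1 - 2 * m\<close> lets the bound on \<open>v\<close> be
  inserted. With \<open>C \<le> (2 * \<rho> - p) * Q\<close> the terms in \<open>\<rho>\<close>
  cancel, leaving \<open>Q / N * (1 - p / P)\<close>; then \<open>P \<le> n\<close> gives
  \<open>(1 - p / P) * r \<le> (1 - p / n) * (1 + p / n) \<le> 1\<close>.\<close>

lemma rate_step:
  assumes "2 * (\<rho> / n powr p) \<le> 1" "v \<le> Q / n powr \<gamma>"
    "v' \<le> (1 - 2 * (\<rho> / n powr p)) * v + C / n powr (p + \<gamma>)"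
  shows "v' \<le> Q / (n + 1) powr \<gamma>"
proof -
  define P N r where "P = n powr p" and "N = n powr \<gamma>" and "r = (1 + 1 / n) powr \<gamma>"
  have pos: "0 < P" "0 < N" "0 < r" using n powr_exponent_bounds add_pos_nonneg[of 1 "1 / n"] by (auto simp: P_def N_def r_def)
  have r: "r \<le> 1 + p / n" unfolding r_def using one_plus_powr_le n p \<gamma> by simp
  have "(1 - p / P) * r \<le> (1 - p / n) * r"
    using pos powr_exponent_bounds n p by (intro mult_right_mono) (auto simp: P_def intro!: divide_left_mono)
  also have "\<dots> \<le> (1 - p / n) * (1 + p / n)"
    using r n p by (intro mult_left_mono) (auto simp: field_simps)
  also have "\<dots> \<le> 1" by (simp add: algebra_simps)
  finally have pr: "1 - p / P \<le> 1 / r" using pos by (simp add: field_simps)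
  have "v' \<le> (1 - 2 * (\<rho> / P)) * v + C / (P * N)"
    using assms(3) by (simp add: P_def N_def powr_add)
  also have "\<dots> \<le> (1 - 2 * (\<rho> / P)) * (Q / N) + ((2 * \<rho> - p) * Q) / (P * N)"
    using assms Q pos by (intro add_mono mult_left_mono divide_right_mono) (auto simp: P_def N_def)
  also have "\<dots> = Q / N * (1 - p / P)"
    using pos by (simp add: field_simps)
  also have "\<dots> \<le> Q / N * (1 / r)"
    using pr pos Q by (intro mult_left_mono) auto
  finally show ?thesis by (simp add: powr_Suc_factor N_def r_def)
qed

text \<open>The number \<open>(m + 1/2)^2\<close> is the maximum of
  \<open>(2 * m - w) * (1 + w)\<close> over real \<open>w\<close>. It is used at
  \<open>w = p / n\<close>, so the bound holds with no information on the preceding error.\<close>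

lemma rate_step_overshoot:
  assumes "v' \<le> (C / n powr (p + \<gamma>)) / (\<rho> / n powr p + 1/2)\<^sup>2"
  shows "v' \<le> Q / (n + 1) powr \<gamma>"
proof -
  define P N r where "P = n powr p" and "N = n powr \<gamma>" and "r = (1 + 1 / n) powr \<gamma>"
  have pos: "0 < P" "0 < N" "0 < r" using n powr_exponent_bounds add_pos_nonneg[of 1 "1 / n"] by (auto simp: P_def N_def r_def)
  have r: "r \<le> 1 + p / n" unfolding r_def using one_plus_powr_le n p \<gamma> by simp
  define u where "u = (\<rho> / P + 1/2)\<^sup>2"
  have "0 < \<rho> / P" using p pos by simp
  then have u: "0 < u" unfolding u_def by (intro zero_less_power) linarith
  have "p / n \<le> p / P" using pos powr_exponent_bounds n p by (auto simp: P_def intro!: divide_left_mono)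
  then have "(2 * \<rho> - p) / P * r \<le> (2 * (\<rho> / P) - p / n) * (1 + p / n)"
    using r n p pos by (intro mult_mono) (auto simp: diff_divide_distrib divide_le_cancel intro: order_trans)
  also have "\<dots> \<le> u"
  proof -
    have "(2 * a - w) * (1 + w) = (a + 1/2)\<^sup>2 - (a - w - 1/2)\<^sup>2" for a w :: real
      by (simp add: power2_eq_square field_simps)
    from this[of "\<rho> / P" "p / n"] show ?thesis
      unfolding u_def using zero_le_power2[of "\<rho> / P - p / n - 1/2"] by linarith
  qed
  finally have "(2 * \<rho> - p) / P / u \<le> 1 / r" using pos u by (simp add: field_simps)
  then have *: "Q / N * ((2 * \<rho> - p) / P / u) \<le> Q / N * (1 / r)"
    using Q pos by (intro mult_left_mono) auto
  have "v' \<le> C / (P * N) / u" using assms by (simp add: P_def N_def powr_add u_def)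
  also have "\<dots> \<le> ((2 * \<rho> - p) * Q) / (P * N) / u"
    using Q pos u by (intro divide_right_mono) auto
  also have "\<dots> = Q / N * ((2 * \<rho> - p) / P / u)" by (simp add: ac_simps)
  also note *
  finally show ?thesis by (simp add: powr_Suc_factor N_def r_def)
qed
end

section \<open>Moments of the scaled kernel\<close>

lemma lborel_integral_affine:
  fixes f :: "'a::euclidean_space \<Rightarrow> real" and t :: 'a
  assumes c: "c \<noteq> 0" and f: "integrable lborel f"
  shows "integrable lborel (\<lambda>x. f (t + c *\<^sub>R x))"
    "(LINT x|lborel. \<bar>c\<bar> ^ DIM('a) * f (t + c *\<^sub>R x)) = (LINT x|lborel. f x)"
proof -
  have [measurable]: "f \<in> borel_measurable borel" using f by auto
  have "integrable (density (distr lborel borel (\<lambda>x. t + c *\<^sub>R x)) (\<lambda>_. \<bar>c\<bar>^DIM('a))) f"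
    using f lborel_affine[OF c, of t] by simp
  then show "integrable lborel (\<lambda>x. f (t + c *\<^sub>R x))"
    using c by (subst (asm) integrable_density) (auto simp: integrable_distr_eq)
  have "(LINT x|lborel. f x) = (LINT x|density (distr lborel borel (\<lambda>x. t + c *\<^sub>R x)) (\<lambda>_. \<bar>c\<bar>^DIM('a)). f x)"
    using lborel_affine[OF c, of t] by simp
  also have "\<dots> = (LINT x|lborel. \<bar>c\<bar> ^ DIM('a) * f (t + c *\<^sub>R x))"
    by (subst integral_density) (auto simp: integral_distr)
  finally show "(LINT x|lborel. \<bar>c\<bar> ^ DIM('a) * f (t + c *\<^sub>R x)) = (LINT x|lborel. f x)" ..
qed

lemma AE_lborel_affine_map:
  fixes P :: "'a::euclidean_space \<Rightarrow> bool"
  assumes c: "c \<noteq> 0" and [measurable]: "Measurable.pred borel P" and P: "AE x in lborel. P x"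
  shows "AE x in lborel. P (t + c *\<^sub>R x)"
proof -
  have "AE x in density (distr lborel borel (\<lambda>x. t + c *\<^sub>R x)) (\<lambda>_. \<bar>c\<bar>^DIM('a)). P x"
    using P by (simp only: lborel_affine[OF c, of t, symmetric])
  then show ?thesis using c by (simp add: AE_density AE_distr_iff)
qed

context
  fixes K :: "'a::euclidean_space \<Rightarrow> real" and h :: real and x :: 'a
  assumes h: "0 < h" and K[measurable]: "K \<in> borel_measurable borel"
begin

text \<open>Displays the normalizing factor as the Jacobian of an affine substitution, so that the
  change of variables for \<open>lborel\<close> applies directly.\<close>

lemma scaled_kernel_affine: "scaled_kernel K h x y = \<bar>1 / h\<bar> ^ DIM('a) * K (- (x /\<^sub>R h) + (1 / h) *\<^sub>R y)"
  using h by (simp add: scaled_kernel_def power_divide scaleR_diff_right inverse_eq_divide)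

lemma scaled_kernel_measurable[measurable]: "scaled_kernel K h x \<in> borel_measurable borel"
  unfolding scaled_kernel_def[abs_def] by measurable

lemma scaled_kernel_integrable:
  assumes "integrable lborel K" shows "integrable lborel (scaled_kernel K h x)"
  unfolding scaled_kernel_affine[abs_def]
  using lborel_integral_affine(1)[OF _ assms, of "1/h" "- (x /\<^sub>R h)"] h by (intro integrable_mult_right) auto

lemma scaled_kernel_moment:
  assumes "integrable lborel (\<lambda>y. norm y powr \<nu> * K y)"
  shows "integrable lborel (\<lambda>y. norm (x - y) powr \<nu> * scaled_kernel K h x y)"
    "(LINT y|lborel. norm (x - y) powr \<nu> * scaled_kernel K h x y) = h powr \<nu> * (LINT y|lborel. norm y powr \<nu> * K y)"
proof -
  have eq: "norm (x - y) powr \<nu> * scaled_kernel K h x y = h powr \<nu> * (\<bar>1 / h\<bar> ^ DIM('a) *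
     (norm (- (x /\<^sub>R h) + (1 / h) *\<^sub>R y) powr \<nu> * K (- (x /\<^sub>R h) + (1 / h) *\<^sub>R y)))" for y
  proof -
    have "x - y = h *\<^sub>R - (- (x /\<^sub>R h) + (1 / h) *\<^sub>R y)"
      using h by (simp add: scaleR_diff_right scaleR_add_right)
    then have "norm (x - y) = h * norm (- (x /\<^sub>R h) + (1 / h) *\<^sub>R y)"
      using h by (metis abs_of_pos norm_minus_cancel norm_scaleR)
    then show ?thesis unfolding scaled_kernel_affine using h by (simp add: powr_mult)
  qed
  show "integrable lborel (\<lambda>y. norm (x - y) powr \<nu> * scaled_kernel K h x y)"
    unfolding eq using lborel_integral_affine(1)[OF _ assms, of "1/h" "- (x /\<^sub>R h)"] h
    by (intro integrable_mult_right) auto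
  show "(LINT y|lborel. norm (x - y) powr \<nu> * scaled_kernel K h x y) = h powr \<nu> * (LINT y|lborel. norm y powr \<nu> * K y)"
    unfolding eq using lborel_integral_affine(2)[OF _ assms, of "1/h" "- (x /\<^sub>R h)"] h
    by (subst integral_mult_right_zero) simp
qed

lemma scaled_kernel_AE_le:
  assumes "AE y in lborel. K y \<le> B"
  shows "AE y in lborel. scaled_kernel K h x y \<le> B / h ^ DIM('a)"
  using AE_lborel_affine_map[OF _ _ assms, of "1/h" "- (x /\<^sub>R h)"] h
  unfolding scaled_kernel_affine
  by (auto simp: power_divide field_simps elim!: eventually_mono)

end

text \<open>The nonnegative function \<open>K y - indicator X y * K y\<close> has integral
  zero.\<close>

lemma AE_zero_outside:
  fixes K :: "'a::euclidean_space \<Rightarrow> real"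
  assumes [measurable]: "X \<in> sets borel" and K: "integrable lborel K" "\<And>y. 0 \<le> K y"
    and eq: "(LINT y:X|lborel. K y) = (LINT y|lborel. K y)"
  shows "AE y in lborel. y \<notin> X \<longrightarrow> K y = 0"
proof -
  have i: "integrable lborel (\<lambda>y. indicator X y * K y)"
    using integrable_mult_indicator[OF _ K(1), of X] by simp
  have "(LINT y|lborel. K y - indicator X y * K y) = 0"
    using eq K i by (subst Bochner_Integration.integral_diff) (auto simp: set_lebesgue_integral_def)
  then have "AE y in lborel. K y - indicator X y * K y = 0"
    using K i by (subst (asm) integral_nonneg_eq_0_iff_AE) (auto simp: indicator_def)
  then show ?thesis by eventually_elim (auto simp: indicator_def split: if_splits)
qed

text \<open>By \<open>mass\<close>, the kernel loses nothing outside \<open>X\<close>, so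
  \<open>e\<close> is a weighted average of \<open>g\<close> over \<open>X\<close>; its distance to
  \<open>g x\<close> is controlled by the Hoelder condition. The second moment is compared with
  \<open>e\<close> itself, since \<open>k^2 \<le> Kbar / h^r * k\<close> almost everywhere
  (\<open>r\<close> the dimension); this linear dependence on \<open>e\<close> is what the one-step
  estimates use.\<close>

lemma (in prob_space) kernel_moments:
  fixes Y :: "'a \<Rightarrow> 'b::euclidean_space"
  assumes [measurable]: "X \<in> sets borel" and Y: "distributed M lborel Y (\<lambda>y. ennreal (indicator X y * g y))"
    and g: "\<And>y. y \<in> X \<Longrightarrow> 0 \<le> g y" "\<And>y. y \<in> X \<Longrightarrow> g y \<le> G"
    and holder: "\<And>y. y \<in> X \<Longrightarrow> \<bar>g x - g y\<bar> \<le> H * norm (x - y) powr \<nu>" and H: "0 \<le> H"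
    and K[measurable]: "K \<in> borel_measurable borel" and K0: "\<And>y. 0 \<le> K y" and Kint: "integrable lborel K"
    and Kbar: "AE y in lborel. K y \<le> Kbar"
    and h: "0 < h" and mass: "(LINT y:X|lborel. scaled_kernel K h x y) = 1"
    and mom: "integrable lborel (\<lambda>y. norm y powr \<nu> * K y)"
  defines "e \<equiv> expectation (\<lambda>\<omega>. scaled_kernel K h x (Y \<omega>))"
  shows "0 \<le> e" "e \<le> G" "\<bar>e - g x\<bar> \<le> H * (h powr \<nu> * (LINT y|lborel. norm y powr \<nu> * K y))"
    "expectation (\<lambda>\<omega>. (scaled_kernel K h x (Y \<omega>))\<^sup>2) \<le> Kbar / h ^ DIM('b) * e"
proof -
  define f where "f y = indicator X y * g y" for y
  define k where "k = scaled_kernel K h x"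
  have f0: "0 \<le> f y" for y using g by (simp add: f_def indicator_def)
  have fmeas[measurable]: "f \<in> borel_measurable borel"
    using distributed_real_measurable[OF _ Y] g unfolding f_def[abs_def] by (simp add: indicator_def)
  have kmeas[measurable]: "k \<in> borel_measurable borel"
    unfolding k_def by (rule scaled_kernel_measurable[OF h K])
  have k0: "0 \<le> k y" for y using K0 h by (simp add: k_def scaled_kernel_def)
  have kint: "integrable lborel k" unfolding k_def by (rule scaled_kernel_integrable[OF h K Kint])
  have kX: "integrable lborel (\<lambda>y. indicator X y * k y)"
    using integrable_mult_indicator[OF _ kint, of X] by simp
  have kX1: "(LINT y|lborel. indicator X y * k y) = 1"
    using mass by (simp add: set_lebesgue_integral_def k_def)
  have kbound: "AE y in lborel. k y \<le> Kbar / h ^ DIM('b)"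
    unfolding k_def by (rule scaled_kernel_AE_le[OF h K Kbar])
  have E: "expectation (\<lambda>\<omega>. \<phi> (Y \<omega>)) = (LINT y|lborel. f y * \<phi> y)"
    if "\<phi> \<in> borel_measurable borel" for \<phi> :: "'b \<Rightarrow> real"
    using distributed_integral[OF Y, of \<phi>] that f0 unfolding f_def by simp
  have e: "e = (LINT y|lborel. f y * k y)"
    unfolding e_def k_def[symmetric] by (rule E) measurable
  show "0 \<le> e" unfolding e using f0 k0 by simp
  have fG: "f y * k y \<le> G * (indicator X y * k y)" for y
    using g k0[of y] by (auto simp: f_def indicator_def intro: mult_right_mono)
  have fk: "integrable lborel (\<lambda>y. f y * k y)"
    by (rule Bochner_Integration.integrable_bound[OF integrable_mult_right[OF kX, of G]])
      (use fG f0 k0 in \<open>auto intro!: AE_I2 order_trans[OF fG abs_ge_self]\<close>)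
  have "(LINT y|lborel. f y * k y) \<le> (LINT y|lborel. G * (indicator X y * k y))"
    by (rule integral_mono[OF fk integrable_mult_right[OF kX] fG])
  then show "e \<le> G" unfolding e by (simp add: kX1)
  have mint: "integrable lborel (\<lambda>y. H * (norm (x - y) powr \<nu> * k y))"
    unfolding k_def by (intro integrable_mult_right scaled_kernel_moment(1)[OF h K mom])
  have dint: "integrable lborel (\<lambda>y. f y * k y - g x * (indicator X y * k y))"
    using fk kX by auto
  have "\<bar>e - g x\<bar> = \<bar>LINT y|lborel. f y * k y - g x * (indicator X y * k y)\<bar>"
    unfolding e using fk kX by (simp add: kX1)
  also have "\<dots> \<le> (LINT y|lborel. \<bar>f y * k y - g x * (indicator X y * k y)\<bar>)"
    by (rule integral_abs_bound)
  also have "\<dots> \<le> (LINT y|lborel. H * (norm (x - y) powr \<nu> * k y))"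
  proof (rule integral_mono[OF integrable_abs[OF dint] mint])
    fix y
    show "\<bar>f y * k y - g x * (indicator X y * k y)\<bar> \<le> H * (norm (x - y) powr \<nu> * k y)"
    proof (cases "y \<in> X")
      case True
      then have "\<bar>f y * k y - g x * (indicator X y * k y)\<bar> = \<bar>g x - g y\<bar> * k y"
        using k0[of y] by (simp add: f_def left_diff_distrib[symmetric] abs_mult abs_minus_commute)
      also have "\<dots> \<le> H * norm (x - y) powr \<nu> * k y"
        using holder[OF True] k0 by (intro mult_right_mono) auto
      finally show ?thesis by (simp add: mult.assoc)
    qed (use H k0 in \<open>simp add: f_def\<close>)
  qed
  also have "\<dots> = H * (h powr \<nu> * (LINT y|lborel. norm y powr \<nu> * K y))"
    unfolding k_def using scaled_kernel_moment(2)[OF h K mom] by simp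
  finally show "\<bar>e - g x\<bar> \<le> H * (h powr \<nu> * (LINT y|lborel. norm y powr \<nu> * K y))" .
  have "expectation (\<lambda>\<omega>. (k (Y \<omega>))\<^sup>2) = (LINT y|lborel. f y * (k y)\<^sup>2)"
    by (rule E) measurable
  also have "\<dots> \<le> (LINT y|lborel. Kbar / h ^ DIM('b) * (f y * k y))"
  proof (rule integral_mono_AE)
    have le: "AE y in lborel. f y * (k y)\<^sup>2 \<le> Kbar / h ^ DIM('b) * (f y * k y)"
      using kbound
    proof eventually_elim
      case (elim y)
      show ?case using mult_right_mono[OF elim, of "f y * k y"] f0 k0 by (simp add: power2_eq_square ac_simps)
    qed
    then show "AE y in lborel. f y * (k y)\<^sup>2 \<le> Kbar / h ^ DIM('b) * (f y * k y)" .
    show "integrable lborel (\<lambda>y. f y * (k y)\<^sup>2)"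
    proof (rule Bochner_Integration.integrable_bound[OF integrable_mult_right[OF fk]])
      show "AE y in lborel. norm (f y * (k y)\<^sup>2) \<le> norm (Kbar / h ^ DIM('b) * (f y * k y))"
        using le
      proof eventually_elim
        case (elim y)
        have "norm (f y * (k y)\<^sup>2) = f y * (k y)\<^sup>2" using f0 by simp
        also note elim
        also have "Kbar / h ^ DIM('b) * (f y * k y) \<le> norm (Kbar / h ^ DIM('b) * (f y * k y))"
          unfolding real_norm_def by (rule abs_ge_self)
        finally show ?case .
      qed
    qed measurable
  qed (use fk in auto)
  also have "\<dots> = Kbar / h ^ DIM('b) * e" by (simp add: e)
  finally show "expectation (\<lambda>\<omega>. (scaled_kernel K h x (Y \<omega>))\<^sup>2) \<le> Kbar / h ^ DIM('b) * e"
    by (simp add: k_def)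
qed

text \<open>A negative \<open>H\<close> would force \<open>X\<close> into the null set
  \<open>{x}\<close>, where every integral vanishes.\<close>

lemma holder_constant_nonneg:
  fixes x :: "'a::euclidean_space"
  assumes "globally_holder_at X g x H \<nu>" and K: "(LINT y:X|lborel. K y) \<noteq> 0"
  shows "0 \<le> H"
proof (rule ccontr)
  assume "\<not> 0 \<le> H"
  have "y = x" if "y \<in> X" for y
  proof -
    have "0 \<le> H * norm (x - y) powr \<nu>"
      using assms(1) that by (auto simp: globally_holder_at_def intro: order_trans[OF abs_ge_zero])
    then show ?thesis using \<open>\<not> 0 \<le> H\<close> by (simp add: zero_le_mult_iff)
  qed
  then have "AE y in lborel. indicator X y *\<^sub>R K y = 0"
    using AE_lborel_singleton[of x] by (auto simp: indicator_def elim!: eventually_mono)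
  then have "(LINT y:X|lborel. K y) = 0"
    unfolding set_lebesgue_integral_def by (intro integral_eq_zero_AE)
  then show False using K by simp
qed

section \<open>The SQG estimates\<close>

text \<open>Independence splits the mean of \<open>Z * \<kappa>\<close>, so only the first two
  moments of \<open>\<kappa>\<close> enter. A bound for each fixed \<open>z\<close> in
  \<open>[0, G]\<close> can then be integrated over the law of \<open>Z\<close>.\<close>

lemma (in prob_space) expectation_step_le:
  fixes Z \<kappa> :: "'a \<Rightarrow> real"
  assumes ind: "indep_var borel Z borel \<kappa>" and Z: "\<And>\<omega>. 0 \<le> Z \<omega>" "\<And>\<omega>. Z \<omega> \<le> G"
    and \<kappa>: "\<And>\<omega>. \<bar>\<kappa> \<omega>\<bar> \<le> B"
    and le: "\<And>z. 0 \<le> z \<Longrightarrow> z \<le> G \<Longrightarrow>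
      ((1 - m) * z - g)\<^sup>2 + 2 * m * ((1 - m) * z - g) * expectation \<kappa> + m\<^sup>2 * expectation (\<lambda>\<omega>. (\<kappa> \<omega>)\<^sup>2)
        \<le> \<alpha> * (z - g)\<^sup>2 + \<beta>"
  shows "expectation (\<lambda>\<omega>. ((1 - m) * Z \<omega> + m * \<kappa> \<omega> - g)\<^sup>2) \<le> \<alpha> * expectation (\<lambda>\<omega>. (Z \<omega> - g)\<^sup>2) + \<beta>"
proof -
  have [measurable]: "Z \<in> borel_measurable M" "\<kappa> \<in> borel_measurable M"
    using indep_var_rv1[OF ind] indep_var_rv2[OF ind] by auto
  have iZ: "integrable M Z" using Z by (intro integrable_const_bound[where B = G]) auto
  have iZ2: "integrable M (\<lambda>\<omega>. (Z \<omega>)\<^sup>2)"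
    using Z by (intro integrable_const_bound[where B = "G\<^sup>2"]) (auto intro!: power_mono)
  have i\<kappa>: "integrable M \<kappa>" using \<kappa> by (intro integrable_const_bound[where B = B]) auto
  have i\<kappa>2: "integrable M (\<lambda>\<omega>. (\<kappa> \<omega>)\<^sup>2)"
    using \<kappa> by (intro integrable_const_bound[where B = "B\<^sup>2"])
      (auto intro!: AE_I2 simp: abs_le_square_iff[symmetric] intro: order_trans[OF _ abs_ge_self])
  have iZ\<kappa>: "integrable M (\<lambda>\<omega>. Z \<omega> * \<kappa> \<omega>)" by (rule indep_var_integrable[OF ind iZ i\<kappa>])
  have EZ\<kappa>: "expectation (\<lambda>\<omega>. Z \<omega> * \<kappa> \<omega>) = expectation Z * expectation \<kappa>"
    by (rule indep_var_lebesgue_integral[OF ind iZ i\<kappa>])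
  note ints = iZ iZ2 i\<kappa> i\<kappa>2 iZ\<kappa>
  define e S where "e = expectation \<kappa>" and "S = expectation (\<lambda>\<omega>. (\<kappa> \<omega>)\<^sup>2)"
  have \<Phi>: "((1 - m) * Z \<omega> - g)\<^sup>2 + 2 * m * ((1 - m) * Z \<omega> - g) * e + m\<^sup>2 * S
    = (1 - m)\<^sup>2 * (Z \<omega>)\<^sup>2 + (2 * m * (1 - m) * e - 2 * (1 - m) * g) * Z \<omega>
        + (m\<^sup>2 * S - 2 * m * g * e + g\<^sup>2)" for \<omega>
    by (simp add: power2_eq_square algebra_simps)
  have "expectation (\<lambda>\<omega>. ((1 - m) * Z \<omega> + m * \<kappa> \<omega> - g)\<^sup>2)
    = expectation (\<lambda>\<omega>. (1 - m)\<^sup>2 * (Z \<omega>)\<^sup>2 + (2 * m * (1 - m)) * (Z \<omega> * \<kappa> \<omega>) + m\<^sup>2 * (\<kappa> \<omega>)\<^sup>2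
        + (- (2 * (1 - m) * g)) * Z \<omega> + (- (2 * m * g)) * \<kappa> \<omega> + g\<^sup>2)"
    by (simp add: power2_eq_square algebra_simps)
  also have "\<dots> = (1 - m)\<^sup>2 * expectation (\<lambda>\<omega>. (Z \<omega>)\<^sup>2) + (2 * m * (1 - m)) * (expectation Z * e) + m\<^sup>2 * S
        + (- (2 * (1 - m) * g)) * expectation Z + (- (2 * m * g)) * e + g\<^sup>2"
    using ints by (simp add: EZ\<kappa> e_def S_def prob_space)
  also have "\<dots> = expectation (\<lambda>\<omega>. (1 - m)\<^sup>2 * (Z \<omega>)\<^sup>2 + (2 * m * (1 - m) * e - 2 * (1 - m) * g) * Z \<omega>
        + (m\<^sup>2 * S - 2 * m * g * e + g\<^sup>2))"
    using ints by (simp add: prob_space algebra_simps)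
  also have "\<dots> = expectation (\<lambda>\<omega>. ((1 - m) * Z \<omega> - g)\<^sup>2 + 2 * m * ((1 - m) * Z \<omega> - g) * e + m\<^sup>2 * S)"
    unfolding \<Phi> ..
  also have "\<dots> \<le> expectation (\<lambda>\<omega>. \<alpha> * (Z \<omega> - g)\<^sup>2 + \<beta>)"
  proof (rule integral_mono)
    show "integrable M (\<lambda>\<omega>. ((1 - m) * Z \<omega> - g)\<^sup>2 + 2 * m * ((1 - m) * Z \<omega> - g) * e + m\<^sup>2 * S)"
      "integrable M (\<lambda>\<omega>. \<alpha> * (Z \<omega> - g)\<^sup>2 + \<beta>)"
      unfolding \<Phi> using ints by (auto simp: power2_diff)
  qed (use le Z in \<open>auto simp: e_def S_def\<close>)
  also have "\<dots> = \<alpha> * expectation (\<lambda>\<omega>. (Z \<omega> - g)\<^sup>2) + \<beta>"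
    using ints by (simp add: power2_diff prob_space)
  finally show ?thesis .
qed

section \<open>Dependence of the estimates on past observations\<close>

text \<open>Feeding in the coordinate projections as observations presents the estimate as a
  function on a finite product space. The estimate with index \<open>s\<close> reads only
  coordinates below \<open>s\<close>.\<close>

lemma sqg_estimate_measurable:
  fixes K :: "'a::euclidean_space \<Rightarrow> real"
  assumes [measurable]: "K \<in> borel_measurable borel" and "s \<le> t"
  shows "sqg_estimate K glo gup \<rho>s \<theta>s (\<lambda>i f. f i) x z0 s \<in> borel_measurable (PiM {..<t} (\<lambda>_. borel))"
  using \<open>s \<le> t\<close>
proof (induction s)
  case 0
  have "sqg_estimate K glo gup \<rho>s \<theta>s (\<lambda>i f. f i) x z0 0 = (\<lambda>_. z0)" by auto
  then show ?case by simp
next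
  case (Suc s)
  then have [measurable]: "sqg_estimate K glo gup \<rho>s \<theta>s (\<lambda>i f. f i) x z0 s \<in> borel_measurable (PiM {..<t} (\<lambda>_. borel))"
    "(\<lambda>f. f s) \<in> PiM {..<t} (\<lambda>_. borel) \<rightarrow>\<^sub>M borel"
    by auto
  have "sqg_estimate K glo gup \<rho>s \<theta>s (\<lambda>i f. f i) x z0 (Suc s) = (\<lambda>f.
      min (gup x) (max (glo x) (sqg_estimate K glo gup \<rho>s \<theta>s (\<lambda>i f. f i) x z0 s f - \<rho>s s *
        (sqg_estimate K glo gup \<rho>s \<theta>s (\<lambda>i f. f i) x z0 s f -
          1 / \<theta>s s ^ DIM('a) * K ((f s - x) /\<^sub>R \<theta>s s)))))"
    by (auto simp: Let_def scaled_kernel_def)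
  also have "\<dots> \<in> borel_measurable (PiM {..<t} (\<lambda>_. borel))" by measurable
  finally show ?case .
qed

lemma sqg_estimate_restrict:
  "s \<le> t \<Longrightarrow> sqg_estimate K glo gup \<rho>s \<theta>s (\<lambda>i f. f i) x z0 s (restrict (\<lambda>i. xbar i \<omega>) {..<t})
    = sqg_estimate K glo gup \<rho>s \<theta>s xbar x z0 s \<omega>"
  by (induction s) (auto simp: Let_def)

text \<open>The estimate is a function of the observations with index in \<open>{..<t}\<close>,
  which is disjoint from \<open>{t}\<close>.\<close>

lemma (in prob_space) sqg_estimate_indep:
  assumes ind: "indep_vars (\<lambda>_. borel) xbar UNIV" and [measurable]: "K \<in> borel_measurable borel" "f \<in> borel_measurable borel"
  shows "indep_var borel (sqg_estimate K glo gup \<rho>s \<theta>s xbar x z0 t) borel (\<lambda>\<omega>. f (xbar t \<omega>))"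
proof -
  have "indep_var (PiM {..<t} (\<lambda>_. borel)) (\<lambda>\<omega>. restrict (\<lambda>i. xbar i \<omega>) {..<t})
     (PiM {t} (\<lambda>_. borel)) (\<lambda>\<omega>. restrict (\<lambda>i. xbar i \<omega>) {t})"
    using ind by (rule indep_var_restrict) auto
  then have "indep_var borel (sqg_estimate K glo gup \<rho>s \<theta>s (\<lambda>i f. f i) x z0 t \<circ> (\<lambda>\<omega>. restrict (\<lambda>i. xbar i \<omega>) {..<t}))
     borel ((\<lambda>w. f (w t)) \<circ> (\<lambda>\<omega>. restrict (\<lambda>i. xbar i \<omega>) {t}))"
    by (rule indep_var_compose) (auto intro!: sqg_estimate_measurable)
  then show ?thesis by (simp add: comp_def sqg_estimate_restrict)
qed

lemma sqg_estimate_bounds: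
  assumes "glo x \<le> z0" "z0 \<le> gup x"
  shows "glo x \<le> sqg_estimate K glo gup \<rho>s \<theta>s xbar x z0 t \<omega>" "sqg_estimate K glo gup \<rho>s \<theta>s xbar x z0 t \<omega> \<le> gup x"
  using assms by (induction t) (auto simp: Let_def)

lemma clip_dist_square_le:
  fixes a b g y :: real
  assumes "a \<le> g" "g \<le> b"
  shows "\<bar>min b (max a y) - g\<bar>\<^sup>2 \<le> (y - g)\<^sup>2"
proof -
  have "\<bar>min b (max a y) - g\<bar> \<le> \<bar>y - g\<bar>" using assms by auto
  then have "\<bar>min b (max a y) - g\<bar>\<^sup>2 \<le> \<bar>y - g\<bar>\<^sup>2" by (intro power_mono) auto
  then show ?thesis by simp
qed


theorem theorem5:
  fixes M :: "'\<omega> measure"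
    and xbar :: "nat \<Rightarrow> '\<omega> \<Rightarrow> 'a::euclidean_space"
    and X :: "'a set" and x :: 'a
    and g glo gup K :: "'a \<Rightarrow> real"
    and gbar Kbar H \<nu> z0 \<rho> \<theta> p q A C Q \<gamma> :: real
    and \<rho>s \<theta>s :: "nat \<Rightarrow> real"
    and t :: nat
  assumes "X \<in> sets borel" and "x \<in> X"
    and "g \<in> density_class X glo gup gbar"
    and "prob_density_on X g"
    and "globally_holder_at X g x H \<nu>"
    and "prob_space M"
    and "prob_space.indep_vars M (\<lambda>_. borel) xbar UNIV"
    and "\<And>s. distributed M lborel (xbar s) (\<lambda>y. ennreal (indicator X y * g y))"
    and "K \<in> borel_measurable borel" and "bounded (range K)"
    and "prob_density_on UNIV K"
    and "(LINT y:X|lborel. K y) = 1"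
    and "(SUP y\<in>X. K y) \<le> Kbar"
    and "integrable lborel (\<lambda>y. norm y powr \<nu> * K y)"
    and "A = (LINT y|lborel. norm y powr \<nu> * K y)"
    and "\<theta> > 0" and "q \<ge> 0" and "0 < p" and "p \<le> 1" and "p < \<rho>"
    and "\<And>s. \<rho>s s = \<rho> / (1 + real s) powr p"
    and "\<And>s. \<theta>s s = \<theta> / (1 + real s) powr q"
    and kernel_inside: "\<And>s. (LINT y:X|lborel. scaled_kernel K (\<theta>s s) x y) = 1"
    and "z0 \<in> {glo x..gup x}"
    and "C = Max {4 * A * H * gbar * \<rho> * \<theta> powr \<nu>,
                  2 * gbar\<^sup>2 * \<rho>\<^sup>2,
                  2 * Kbar * gbar * \<rho>\<^sup>2 / \<theta> ^ DIM('a)}"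
    and "Q = max (\<bar>z0 - g x\<bar>\<^sup>2) (C / (2 * \<rho> - p))"
    and "\<gamma> = Min {\<nu> * q, p, p - DIM('a) * q}"
  shows "prob_space.expectation M
           (\<lambda>\<omega>. \<bar>sqg_estimate K glo gup \<rho>s \<theta>s xbar x z0 t \<omega> - g x\<bar>\<^sup>2)
         \<le> Q / (1 + real t) powr \<gamma>"
proof -
  interpret prob_space M by fact
  note X = assms(1) and x = assms(2) and K = assms(9) and mom = assms(14)
  have cls: "0 \<le> glo y" "glo y \<le> g y" "g y \<le> gup y" "gup y \<le> gbar" if "y \<in> X" for y
    using assms(3) that by (auto simp: density_class_def)
  have g: "0 \<le> g y" "g y \<le> gbar" if "y \<in> X" for y using cls[OF that] by auto
  have K0: "0 \<le> K y" for y using assms(11) by (simp add: prob_density_on_def)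
  have Kint: "integrable lborel K" and K1: "(LINT y|lborel. K y) = 1"
    using assms(11) by (simp_all add: prob_density_on_def set_integrable_def set_lebesgue_integral_def)
  have H: "0 \<le> H" using holder_constant_nonneg[OF assms(5), of K] assms(12) by simp
  have gbar: "0 < gbar"
  proof (rule ccontr)
    assume "\<not> 0 < gbar"
    then have "indicator X y *\<^sub>R g y = 0" for y
      using g[of y] by (auto simp: indicator_def)
    then have "(LINT y:X|lborel. g y) = 0" by (simp only: set_lebesgue_integral_def) simp
    then show False using assms(4) by (simp add: prob_density_on_def)
  qed
  have KX: "K y \<le> Kbar" if "y \<in> X" for y
  proof -
    \<comment> \<open>A real \<open>SUP\<close> dominates the values only when they are bounded
      above.\<close>
    have "bdd_above (K ` X)"
      using bounded_imp_bdd_above[OF assms(10)] by (rule bdd_above_mono) auto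
    then show ?thesis using cSUP_upper[of y X K] that assms(13) by simp
  qed
  \<comment> \<open>\<open>K\<close> has the same mass on \<open>X\<close> as on the whole space, so the bound on \<open>X\<close> also applies to
    the rescaled arguments \<open>(y - x) / h\<close>, which may leave \<open>X\<close>.\<close>
  have "AE y in lborel. y \<notin> X \<longrightarrow> K y = 0"
    using AE_zero_outside[OF X Kint K0] assms(12) K1 by simp
  \<comment> \<open>Where \<open>K y = 0\<close>, the chain \<open>0 \<le> K x \<le> Kbar\<close> at
    the point \<open>x\<close> of \<open>X\<close> gives the bound.\<close>
  then have Kbar: "AE y in lborel. K y \<le> Kbar"
    by eventually_elim (use KX KX[OF x] K0[of x] in \<open>metis order_trans\<close>)
  obtain B where B: "\<And>y. \<bar>K y\<bar> \<le> B"
    using assms(10) by (auto simp: bounded_iff)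
  have C: "4 * A * H * gbar * \<rho> * \<theta> powr \<nu> \<le> C" "2 * gbar\<^sup>2 * \<rho>\<^sup>2 \<le> C"
    "2 * Kbar * gbar * \<rho>\<^sup>2 / \<theta> ^ DIM('a) \<le> C"
    unfolding assms(25) by (auto intro!: Max_ge)
  have "0 \<le> 2 * gbar\<^sup>2 * \<rho>\<^sup>2" by simp
  \<comment> \<open>This local label shadows the lemma of the same name; nonnegativity of
    \<open>C\<close> is used in \<open>frac\<close>.\<close>
  then have overshoot_scalar_le: "0 \<le> C" using C(2) by linarith
  have \<gamma>: "\<gamma> \<le> \<nu> * q" "\<gamma> \<le> p" "\<gamma> \<le> p - DIM('a) * q"
    unfolding assms(27) by (auto intro!: Min_le)
  have Q0: "0 \<le> Q" unfolding assms(26) by (simp add: le_max_iff_disj)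
  have "C / (2 * \<rho> - p) \<le> Q" unfolding assms(26) by simp
  then have CQ: "C \<le> (2 * \<rho> - p) * Q"
    using assms(18,20) by (simp add: field_simps)
  define z where "z = sqg_estimate K glo gup \<rho>s \<theta>s xbar x z0"
  define v where "v s = expectation (\<lambda>\<omega>. (z s \<omega> - g x)\<^sup>2)" for s
  have z: "glo x \<le> z s \<omega>" "z s \<omega> \<le> gup x" for s \<omega>
    unfolding z_def using sqg_estimate_bounds[of glo x z0 gup] assms(24) by auto
  have zG: "0 \<le> z s \<omega>" "z s \<omega> \<le> gbar" for s \<omega>
    using z[of s \<omega>] cls[OF x] by auto
  \<comment> \<open>The trivial bound, for overshooting steps with large \<open>D\<close>.\<close>
  have v_le: "v s \<le> gbar\<^sup>2" for s
  proof -
    have "\<bar>(z s \<omega> - g x)\<^sup>2\<bar> \<le> gbar\<^sup>2" for \<omega>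
    proof -
      have "\<bar>z s \<omega> - g x\<bar> \<le> gbar" using zG[of s \<omega>] g[OF x] by auto
      then show ?thesis by (metis abs_ge_zero abs_power2 power2_abs power_mono)
    qed
    then have "expectation (\<lambda>\<omega>. (z s \<omega> - g x)\<^sup>2) \<le> expectation (\<lambda>_. gbar\<^sup>2)"
      by (intro integral_mono') (auto intro: order_trans[OF abs_ge_self])
    then show ?thesis by (simp add: v_def prob_space)
  qed
  have "v s \<le> Q / (1 + real s) powr \<gamma>" for s
  proof (induction s)
    case 0
    then show ?case by (simp add: v_def z_def prob_space assms(26))
  next
    case (Suc s)
    define n m h where "n = 1 + real s" and "m = \<rho> / n powr p" and "h = \<theta> / n powr q"
    define \<kappa> where "\<kappa> \<omega> = scaled_kernel K h x (xbar s \<omega>)" for \<omega>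
    define e S k b D where "e = expectation \<kappa>" and "S = expectation (\<lambda>\<omega>. (\<kappa> \<omega>)\<^sup>2)"
      and "k = Kbar / h ^ DIM('a)" and "b = H * (h powr \<nu> * A)" and "D = C / n powr (p + \<gamma>)"
    have n: "1 \<le> n" by (simp add: n_def)
    have h: "0 < h" using n assms(16) by (simp add: h_def)
    have m: "0 < m" using n assms(18,20) by (simp add: m_def)
    have sched: "\<rho>s s = m" "\<theta>s s = h" by (simp_all add: assms(21,22) m_def h_def n_def)
    have mass: "(LINT y:X|lborel. scaled_kernel K h x y) = 1"
      using kernel_inside[of s] by (simp add: sched)
    have moments: "0 \<le> e" "e \<le> gbar" "\<bar>e - g x\<bar> \<le> b" "S \<le> k * e"
      using kernel_moments[OF X assms(8)[of s] g _ H K K0 Kint Kbar h mass mom] assms(5)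
      unfolding e_def S_def k_def b_def \<kappa>_def assms(15) by (auto simp: globally_holder_at_def)
    \<comment> \<open>Pairs each entry \<open>a\<close> of the maximum \<open>C\<close> with its own
      exponent; since \<open>n \<ge> 1\<close>, lowering the exponent to \<open>p + \<gamma>\<close>
      only enlarges the quotient. The exponents are \<open>p + p\<close>,
      \<open>p + (p - DIM('a) * q)\<close> and \<open>p + \<nu> * q\<close>.\<close>
    have frac: "a / n powr r \<le> D" if "a \<le> C" "p + \<gamma> \<le> r" for a r
      unfolding D_def using that n overshoot_scalar_le by (intro frac_le powr_mono) auto
    have D1: "2 * m\<^sup>2 * gbar\<^sup>2 \<le> D"
    proof -
      have "2 * m\<^sup>2 * gbar\<^sup>2 = (2 * gbar\<^sup>2 * \<rho>\<^sup>2) / n powr (2 * p)"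
        using powr_add[of n p p, folded mult_2] by (simp add: m_def power2_eq_square)
      also have "\<dots> \<le> D" using C \<gamma> by (intro frac) auto
      finally show ?thesis .
    qed
    have D2: "2 * m\<^sup>2 * k * gbar \<le> D"
    proof -
      have "h ^ DIM('a) = \<theta> ^ DIM('a) / n powr (DIM('a) * q)"
        using n by (simp add: h_def power_divide powr_powr[symmetric] powr_realpow mult.commute)
      then have "2 * m\<^sup>2 * k * gbar = (2 * Kbar * gbar * \<rho>\<^sup>2 / \<theta> ^ DIM('a)) / n powr (p + (p - DIM('a) * q))"
        using powr_add[of n p p, folded mult_2]
        by (simp add: m_def k_def powr_diff powr_add power2_eq_square ac_simps)
      also have "\<dots> \<le> D" using C \<gamma> by (intro frac) auto
      finally show ?thesis .
    qed
    have D3: "4 * m * gbar * b \<le> D"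
    proof -
      have "h powr \<nu> = \<theta> powr \<nu> / n powr (\<nu> * q)"
        using n assms(16) by (simp add: h_def powr_divide powr_powr mult.commute)
      then have "4 * m * gbar * b = (4 * A * H * gbar * \<rho> * \<theta> powr \<nu>) / n powr (p + \<nu> * q)"
        by (simp add: m_def b_def powr_add)
      also have "\<dots> \<le> D" using C \<gamma> by (intro frac) auto
      finally show ?thesis .
    qed
    have ind: "indep_var borel (z s) borel \<kappa>"
      unfolding z_def \<kappa>_def
      by (rule sqg_estimate_indep[OF assms(7) K scaled_kernel_measurable[OF h K]])
    have \<kappa>B: "\<bar>\<kappa> \<omega>\<bar> \<le> 1 / h ^ DIM('a) * B" for \<omega>
      unfolding \<kappa>_def scaled_kernel_def abs_mult using h B by (intro mult_mono) auto
    have "v (Suc s) \<le> expectation (\<lambda>\<omega>. ((1 - m) * z s \<omega> + m * \<kappa> \<omega> - g x)\<^sup>2)"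
      unfolding v_def
    proof (rule integral_mono')
      have [measurable]: "z s \<in> borel_measurable M" "\<kappa> \<in> borel_measurable M"
        using indep_var_rv1[OF ind] indep_var_rv2[OF ind] by auto
      have "\<bar>(1 - m) * z s \<omega> + m * \<kappa> \<omega> - g x\<bar> \<le> \<bar>1 - m\<bar> * gbar + m * (1 / h ^ DIM('a) * B) + gbar" for \<omega>
      proof -
        have "\<bar>(1 - m) * z s \<omega>\<bar> \<le> \<bar>1 - m\<bar> * gbar" "\<bar>m * \<kappa> \<omega>\<bar> \<le> m * (1 / h ^ DIM('a) * B)" "\<bar>g x\<bar> \<le> gbar"
          unfolding abs_mult using zG[of s \<omega>] mult_left_mono[OF \<kappa>B[of \<omega>], of m] m g[OF x]
          by (auto intro!: mult_mono)
        then show ?thesis by linarith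
      qed
      then show "integrable M (\<lambda>\<omega>. ((1 - m) * z s \<omega> + m * \<kappa> \<omega> - g x)\<^sup>2)"
        by (intro integrable_const_bound[where B = "(\<bar>1 - m\<bar> * gbar + m * (1 / h ^ DIM('a) * B) + gbar)\<^sup>2"])
          (auto intro!: AE_I2 simp: abs_le_square_iff[symmetric] intro: order_trans[OF _ abs_ge_self])
      show "(z (Suc s) \<omega> - g x)\<^sup>2 \<le> ((1 - m) * z s \<omega> + m * \<kappa> \<omega> - g x)\<^sup>2" for \<omega>
      proof -
        have "z (Suc s) \<omega> = min (gup x) (max (glo x) ((1 - m) * z s \<omega> + m * \<kappa> \<omega>))"
          by (simp add: z_def \<kappa>_def Let_def sched algebra_simps)
        then show ?thesis using clip_dist_square_le[of "glo x" "g x" "gup x"] cls[OF x] by simp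
      qed
    qed auto
    \<comment> \<open>What is left to supply is the quadratic bound for fixed \<open>z\<close>: with
      factor \<open>1 - 2 * m\<close> on the old error if \<open>2 * m \<le> 1\<close>, and with
      factor \<open>0\<close> for an overshooting step.\<close>
    note step = order_trans[OF this expectation_step_le[OF ind zG \<kappa>B]]
    have rate: "1 \<le> n" "0 < p" "p \<le> 1" "p < \<rho>" "\<gamma> \<le> p" "C \<le> (2 * \<rho> - p) * Q" "0 \<le> Q"
      using n assms(18-20) \<gamma> CQ Q0 by auto
    have "v (Suc s) \<le> Q / (n + 1) powr \<gamma>"
    proof (cases "2 * m \<le> 1")
      case True
      have "v (Suc s) \<le> (1 - 2 * m) * expectation (\<lambda>\<omega>. (z s \<omega> - g x)\<^sup>2) + D"
      proof (rule step)
        fix y assume "0 \<le> y" "y \<le> gbar"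
        then show "((1 - m) * y - g x)\<^sup>2 + 2 * m * ((1 - m) * y - g x) * expectation \<kappa>
            + m\<^sup>2 * expectation (\<lambda>\<omega>. (\<kappa> \<omega>)\<^sup>2) \<le> (1 - 2 * m) * (y - g x)\<^sup>2 + D"
          using step_moment_le[of m y gbar "g x" e S k D b] m moments D1 D2 D3 g[OF x] gbar
          by (simp add: e_def S_def)
      qed
      then show ?thesis
        using rate_step[OF rate, of "v s" "v (Suc s)"] True Suc.IH
        by (simp add: m_def D_def v_def n_def)
    next
      case False
      have "v (Suc s) \<le> D / (m + 1/2)\<^sup>2"
      proof (cases "D \<le> (m + 1/2)\<^sup>2 * gbar\<^sup>2")
        case True
        have "v (Suc s) \<le> 0 * expectation (\<lambda>\<omega>. (z s \<omega> - g x)\<^sup>2) + D / (m + 1/2)\<^sup>2"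
        proof (rule step)
          fix y assume "0 \<le> y" "y \<le> gbar"
          then show "((1 - m) * y - g x)\<^sup>2 + 2 * m * ((1 - m) * y - g x) * expectation \<kappa>
              + m\<^sup>2 * expectation (\<lambda>\<omega>. (\<kappa> \<omega>)\<^sup>2) \<le> 0 * (y - g x)\<^sup>2 + D / (m + 1/2)\<^sup>2"
            using overshoot_moment_le[of m y gbar "g x" e S k D b] False moments D1 D2 D3 g[OF x] gbar True
            by (simp add: e_def S_def)
        qed
        then show ?thesis by simp
      next
        case False
        have "0 < (m + 1/2)\<^sup>2" using m by (intro zero_less_power) linarith
        then have "gbar\<^sup>2 \<le> D / (m + 1/2)\<^sup>2"
          using False by (simp add: pos_le_divide_eq mult.commute)
        then show ?thesis using v_le[of "Suc s"] by linarith
      qed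
      then show ?thesis
        using rate_step_overshoot[OF rate, of "v (Suc s)"] by (simp add: m_def D_def)
    qed
    then show ?case by (simp add: n_def add.commute add.left_commute)
  qed
  from this[of t] show ?thesis by (simp add: v_def z_def)
qed

end
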